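(* Let $d$ be a non-negative integer. Any lattice simplex of degree $\leq d$ and dimension $n \geq 4d-1$ is a lattice pyramid over an $(n-1)$-dimensional lattice simplex.
   Context: A lattice $M$ is a free abelian group of finite rank, and $M_{\mathbb{R}} = M \otimes_{\mathbb{Z}} \mathbb{R}$. A lattice polytope $P \subseteq M_{\mathbb{R}}$ is a polytope all of whose vertices lie in $M$; a lattice simplex is a lattice polytope that is a simplex. All lattice notions for $P$ are taken with respect to the affine lattice $\operatorname{aff}(P) \cap M$. For an $n$-dimensional lattice polytope $P$ one has $$\sum_{k \geq 0} |kP \cap M|\, t^k = \frac{h^*_0 + h^*_1 t + \cdots + h^*_n t^n}{(1-t)^{n+1}}$$ with non-negative integers $h^*_i$ (for $k=0$ the number of lattice points is $1$). The numerator is the $h^*$-polynomial of $P$, and the degree $\deg(P)$ of $P$ is the maximal $i$ with $h^*_i \neq 0$. Two lattice polytopes $P \subseteq M_{\mathbb{R}}$ and $P' \subseteq M'_{\mathbb{R}}$ are isomorphic if there is an affine lattice isomorphism $\operatorname{aff}(P)\cap M \cong \operatorname{aff}(P')\cap M'$ mapping the vertices of $P$ onto the vertices of $P'$. For a lattice polytope $B \subseteq \mathbb{R}^k$ with respect to $\mathbb{Z}^k$, the ($1$-fold) standard pyramid over $B$ is $\operatorname{conv}(\{0\} \cup (B \times \{1\})) \subseteq \mathbb{R}^{k+1}$, a lattice polytope with respect to $\mathbb{Z}^{k+1}$; the $l$-fold standard pyramid is obtained by iterating this $l$ times, and the $0$-fold standard pyramid over $B$ is $B$ itself. For lattice polytopes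 $Q \subseteq P$, we say that $P$ is a lattice pyramid over $Q$ if $P$ is isomorphic to the $(\dim(P)-\dim(Q))$-fold standard pyramid over some lattice polytope $B$ by an isomorphism mapping $Q$ onto the copy of $B$ in this standard pyramid. Convention: the empty set counts as a lattice simplex of dimension $-1$, and a single lattice point is a lattice pyramid over it. *)

theory Defs
  imports
    "HOL-Analysis.Analysis"
    "HOL-Analysis.Finite_Function_Topology"
    "HOL-Computational_Algebra.Polynomial_FPS"
begin

text \<open>
  A lattice of finite rank is realised as the integer span of a finite linearly independent
  set; its real scalar extension is then its linear span. The rank may be smaller than the
  dimension of the surrounding space, and may be 0.
\<close>

definition is_lattice :: "'a::real_vector set \<Rightarrow> bool" where
  "is_lattice M \<longleftrightarrow>
     (\<exists>A. finite A \<and> independent A \<and>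
          M = {v. \<exists>c :: 'a \<Rightarrow> int. v = (\<Sum>a\<in>A. of_int (c a) *\<^sub>R a)})"

definition vertices :: "'a::real_vector set \<Rightarrow> 'a set" where
  "vertices P = {v. v extreme_point_of P}"

definition lattice_polytope :: "'a::real_vector set \<Rightarrow> 'a set \<Rightarrow> bool" where
  "lattice_polytope M P \<longleftrightarrow> polytope P \<and> vertices P \<subseteq> M"

text \<open>The empty set is a lattice simplex, of dimension \<open>aff_dim {} = -1\<close>.\<close>

definition lattice_simplex :: "'a::euclidean_space set \<Rightarrow> 'a set \<Rightarrow> bool" where
  "lattice_simplex M P \<longleftrightarrow> lattice_polytope M P \<and> (\<exists>n. n simplex P)"

definition ehrhart_series :: "'a::real_vector set \<Rightarrow> 'a set \<Rightarrow> int fps" where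
  "ehrhart_series M P = Abs_fps (\<lambda>k. int (card ((\<lambda>x. real k *\<^sub>R x) ` P \<inter> M)))"

text \<open>
  For a nonempty lattice polytope \<open>P\<close> the polynomial exists by Ehrhart's theorem; it is
  unique because \<open>fps_of_poly\<close> is injective.
\<close>

definition hstar_poly :: "'a::euclidean_space set \<Rightarrow> 'a set \<Rightarrow> int poly" where
  "hstar_poly M P =
     (THE h. ehrhart_series M P * (1 - fps_X) ^ nat (aff_dim P + 1) = fps_of_poly h)"

definition lattice_degree :: "'a::euclidean_space set \<Rightarrow> 'a set \<Rightarrow> nat" where
  "lattice_degree M P = degree (hstar_poly M P)"

text \<open>
  An isomorphism is a map between the lattice points of the affine hulls only. On such a set,
  being affine over the integers amounts to preserving the combinations \<open>x - y + z\<close>.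
\<close>

definition affine_lattice_iso ::
    "('a::real_vector \<Rightarrow> 'b::real_vector) \<Rightarrow> 'a set \<Rightarrow> 'b set \<Rightarrow> bool" where
  "affine_lattice_iso f L L' \<longleftrightarrow>
     bij_betw f L L' \<and> (\<forall>x\<in>L. \<forall>y\<in>L. \<forall>z\<in>L. f (x - y + z) = f x - f y + f z)"

definition lattice_polytope_iso ::
    "('a::real_vector \<Rightarrow> 'b::real_vector) \<Rightarrow> 'a set \<Rightarrow> 'a set \<Rightarrow> 'b set \<Rightarrow> 'b set \<Rightarrow> bool" where
  "lattice_polytope_iso f M P M' P' \<longleftrightarrow>
     affine_lattice_iso f (affine hull P \<inter> M) (affine hull P' \<inter> M') \<and>
     f ` vertices P = vertices P'"

text \<open>
  To have all the spaces \<open>\<real>\<^sup>k\<close> in one type, \<open>\<real>\<^sup>k\<close> is taken to be the set of finitely supported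
  real sequences with support in \<open>{..<k}\<close>. A point \<open>(x, t)\<close> of \<open>\<real>\<^sup>k \<times> \<real>\<close> is then
  \<open>x + single k t\<close>, so \<open>height_one k B\<close> below is \<open>B \<times> {1}\<close> in \<open>\<real>\<^sup>k\<^sup>+\<^sup>1\<close>.
\<close>

definition int_lattice :: "nat \<Rightarrow> (nat \<Rightarrow>\<^sub>0 real) set" where
  "int_lattice k =
     {x. Poly_Mapping.keys x \<subseteq> {..<k} \<and> (\<forall>i. Poly_Mapping.lookup x i \<in> \<int>)}"

definition height_one :: "nat \<Rightarrow> (nat \<Rightarrow>\<^sub>0 real) set \<Rightarrow> (nat \<Rightarrow>\<^sub>0 real) set" where
  "height_one k B = (\<lambda>x. x + Poly_Mapping.single k 1) ` B"

primrec standard_pyramid ::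
    "nat \<Rightarrow> nat \<Rightarrow> (nat \<Rightarrow>\<^sub>0 real) set \<Rightarrow> (nat \<Rightarrow>\<^sub>0 real) set" where
  "standard_pyramid 0 k B = B"
| "standard_pyramid (Suc l) k B =
     convex hull (insert 0 (height_one (k + l) (standard_pyramid l k B)))"

text \<open>The copy of \<open>B\<close> inside the \<open>l\<close>-fold standard pyramid over \<open>B\<close>.\<close>

primrec pyramid_base ::
    "nat \<Rightarrow> nat \<Rightarrow> (nat \<Rightarrow>\<^sub>0 real) set \<Rightarrow> (nat \<Rightarrow>\<^sub>0 real) set" where
  "pyramid_base 0 k B = B"
| "pyramid_base (Suc l) k B = height_one (k + l) (pyramid_base l k B)"

text \<open>
  Since the isomorphism is defined on lattice points, mapping \<open>Q\<close> onto the copy of \<open>B\<close> means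
  mapping vertices onto vertices, as in \<open>lattice_polytope_iso\<close>. A single lattice point is a
  lattice pyramid over \<open>{}\<close>: take \<open>B = {}\<close>, whose 1-fold standard pyramid is \<open>{0}\<close>.
\<close>

definition lattice_pyramid :: "'a::euclidean_space set \<Rightarrow> 'a set \<Rightarrow> 'a set \<Rightarrow> bool" where
  "lattice_pyramid M P Q \<longleftrightarrow>
     lattice_polytope M P \<and> lattice_polytope M Q \<and> Q \<subseteq> P \<and>
     (\<exists>k B f. let l = nat (aff_dim P - aff_dim Q) in
        lattice_polytope (int_lattice k) B \<and>
        lattice_polytope_iso f M P (int_lattice (k + l)) (standard_pyramid l k B) \<and>
        f ` vertices Q = vertices (pyramid_base l k B))"

end

theory Submission
  imports Defs
begin

text \<open>
  Reduce the barycentric coordinates of the lattice points in the cone over the simplex modulo 1: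
  the fractional parts form a finite abelian group \<open>G\<close> of vectors, and sorting lattice points by
  fractional part shows that \<open>h\<^sup>*\<^sub>i\<close> counts the elements of \<open>G\<close> whose coordinate sum (height) is
  \<open>i\<close>. If every coordinate is nonzero somewhere on \<open>G\<close>, then each is nonzero on at least half of
  \<open>G\<close>; pairing \<open>\<beta>\<close> with its inverse, each has average at least \<open>1/4\<close>. Hence the average height is
  at least \<open>(n + 1) / 4\<close>. But it is at most \<open>d (1 - 1 / |G|)\<close>, because 0 has height 0, contradicting
  \<open>n + 1 \<ge> 4 d\<close>. So some coordinate vanishes on \<open>G\<close>, that is, it is integral on all lattice points,
  and the corresponding vertex is the apex of a lattice pyramid.
\<close>

subsection \<open>Lattices and lattice polytopes\<close>

lemma vertices_convex_hull:
  assumes "finite S" "\<not> affine_dependent S"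
  shows "vertices (convex hull S) = S"
proof
  show "vertices (convex hull S) \<subseteq> S"
    using extreme_points_of_convex_hull by (auto simp: vertices_def)
  show "S \<subseteq> vertices (convex hull S)"
  proof
    fix a assume "a \<in> S"
    then have "a \<notin> convex hull (S - {a})"
      using assms(2) convex_hull_subset_affine_hull by (auto simp: affine_dependent_def)
    with \<open>a \<in> S\<close> assms(1) show "a \<in> vertices (convex hull S)"
      using extreme_point_of_convex_hull_insert[of "S - {a}" a]
      by (simp add: vertices_def insert_absorb)
  qed
qed

lemma lattice_polytope_convex_hull:
  assumes "finite S" "S \<subseteq> M"
  shows "lattice_polytope M (convex hull S)"
proof -
  have "polytope (convex hull S)" unfolding polytope_def using assms(1) by blast
  moreover have "vertices (convex hull S) \<subseteq> S"
    using extreme_points_of_convex_hull by (auto simp: vertices_def)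
  ultimately show ?thesis using assms(2) by (simp add: lattice_polytope_def)
qed

lemma lattice_zero: "is_lattice M \<Longrightarrow> 0 \<in> M"
  unfolding is_lattice_def by (force intro!: exI[of _ "\<lambda>_. 0"])

lemma lattice_diff:
  fixes M :: "'a::real_vector set"
  assumes "is_lattice M" "x \<in> M" "y \<in> M"
  shows "x - y \<in> M"
proof -
  obtain A where M: "M = {v. \<exists>c :: 'a \<Rightarrow> int. v = (\<Sum>a\<in>A. of_int (c a) *\<^sub>R a)}"
    using assms(1) unfolding is_lattice_def by blast
  obtain c d where "x = (\<Sum>a\<in>A. of_int (c a) *\<^sub>R a)" "y = (\<Sum>a\<in>A. of_int (d a) *\<^sub>R a)"
    using assms(2,3) M by blast
  then show ?thesis
    unfolding M by (auto simp: sum_subtractf scaleR_diff_left intro!: exI[of _ "\<lambda>a. c a - d a"])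
qed

lemma lattice_uminus: "is_lattice M \<Longrightarrow> x \<in> M \<Longrightarrow> - x \<in> M"
  using lattice_diff[of M 0 x] by (simp add: lattice_zero)

lemma lattice_add: "is_lattice M \<Longrightarrow> x \<in> M \<Longrightarrow> y \<in> M \<Longrightarrow> x + y \<in> M"
  using lattice_diff[of M x "- y"] by (simp add: lattice_uminus)

lemma lattice_sum:
  assumes "is_lattice M" "\<And>i. i \<in> I \<Longrightarrow> f i \<in> M"
  shows "sum f I \<in> M"
  using assms(2) by (induction I rule: infinite_finite_induct)
    (auto simp: lattice_zero[OF assms(1)] intro: lattice_add[OF assms(1)])

lemma lattice_scale_int:
  assumes "is_lattice M" "x \<in> M"
  shows "of_int k *\<^sub>R x \<in> M"
proof -
  have nat: "real m *\<^sub>R x \<in> M" for m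
    by (induction m)
      (auto simp: lattice_zero[OF assms(1)] scaleR_add_left intro: lattice_add[OF assms])
  show ?thesis
    by (cases k rule: int_cases2)
      (use nat lattice_uminus[OF assms(1)] in \<open>auto simp: scaleR_minus_left\<close>)
qed

text \<open>The dual functionals, extended linearly to the whole space, read off integer
  coefficients. Both the finiteness of bounded pieces of \<open>M\<close> and the coordinates on
  \<open>M\<close> rest on them.\<close>

lemma lattice_dual_basis:
  fixes M :: "'a::euclidean_space set"
  assumes "is_lattice M"
  obtains A and g :: "'a \<Rightarrow> 'a \<Rightarrow> real"
  where "finite A" "M = range (\<lambda>c :: 'a \<Rightarrow> int. \<Sum>a\<in>A. of_int (c a) *\<^sub>R a)"
    "\<And>a. linear (g a)" "\<And>a c. a \<in> A \<Longrightarrow> g a (\<Sum>b\<in>A. c b *\<^sub>R b) = c a"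
proof -
  obtain A where A: "finite A" "independent A"
    and M: "M = {v. \<exists>c :: 'a \<Rightarrow> int. v = (\<Sum>a\<in>A. of_int (c a) *\<^sub>R a)}"
    using assms unfolding is_lattice_def by blast
  have "\<exists>g::'a \<Rightarrow> real. linear g \<and> (\<forall>b\<in>A. g b = (if b = a then 1 else 0))" for a
    using linear_independent_extend[OF A(2), of "\<lambda>b. if b = a then 1 else 0 :: real"] by blast
  then obtain g :: "'a \<Rightarrow> 'a \<Rightarrow> real" where lin: "\<And>a. linear (g a)"
    and g: "\<And>a b. b \<in> A \<Longrightarrow> g a b = (if b = a then 1 else 0)"
    by metis
  have "g a (\<Sum>b\<in>A. c b *\<^sub>R b) = c a" if "a \<in> A" for a c
    using that A(1) by (simp add: linear_sum[OF lin] linear_cmul[OF lin] g if_distrib cong: if_cong)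
  with A(1) M lin show thesis by (intro that[of A g]) auto
qed

text \<open>Each dual functional is bounded on \<open>S\<close>, which leaves finitely many integer
  values for every coefficient.\<close>

lemma finite_bounded_Int_lattice:
  fixes M S :: "'a::euclidean_space set"
  assumes "is_lattice M" "bounded S"
  shows "finite (S \<inter> M)"
proof -
  obtain A and g :: "'a \<Rightarrow> 'a \<Rightarrow> real" where A: "finite A"
    and M: "M = range (\<lambda>c :: 'a \<Rightarrow> int. \<Sum>a\<in>A. of_int (c a) *\<^sub>R a)"
    and lin: "\<And>a. linear (g a)"
    and g_eval: "\<And>a c. a \<in> A \<Longrightarrow> g a (\<Sum>b\<in>A. c b *\<^sub>R b) = c a"
    by (rule lattice_dual_basis[OF assms(1)]) (rule that)
  have "\<exists>K. \<forall>x\<in>S. \<bar>g a x\<bar> \<le> of_int K" for a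
  proof -
    have "bounded (g a ` S)"
      using bounded_linear_image[OF assms(2)] lin linear_conv_bounded_linear by blast
    then obtain k where "\<And>x. x \<in> S \<Longrightarrow> \<bar>g a x\<bar> \<le> k"
      unfolding bounded_iff by auto
    then show ?thesis
      by (meson le_of_int_ceiling order_trans)
  qed
  then obtain K where K: "\<And>a x. x \<in> S \<Longrightarrow> \<bar>g a x\<bar> \<le> of_int (K a)"
    by metis
  let ?E = "\<lambda>c :: 'a \<Rightarrow> int. \<Sum>a\<in>A. of_int (c a) *\<^sub>R a"
  have "S \<inter> M \<subseteq> ?E ` (PiE A (\<lambda>a. {- K a..K a}))"
  proof
    fix x assume x: "x \<in> S \<inter> M"
    then obtain c where c: "x = ?E c" using M by blast
    have "\<bar>of_int (c a) :: real\<bar> \<le> of_int (K a)" if "a \<in> A" for a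
      using K[of x a] x g_eval[OF that] c by simp
    then have "\<bar>c a\<bar> \<le> K a" if "a \<in> A" for a
      using that by (metis of_int_abs of_int_le_iff)
    then have "restrict c A \<in> PiE A (\<lambda>a. {- K a..K a})"
      by (auto simp: abs_le_iff) (smt (verit, best))+
    moreover have "x = ?E (restrict c A)" using c by simp
    ultimately show "x \<in> ?E ` (PiE A (\<lambda>a. {- K a..K a}))" by blast
  qed
  then show ?thesis
    by (rule finite_subset) (simp add: A finite_PiE)
qed

subsection \<open>Weak compositions\<close>

text \<open>Vanishing off \<open>S\<close> makes the functions representing compositions unique, so
  that they can be counted.\<close>

definition weak_compositions :: "'b set \<Rightarrow> nat \<Rightarrow> ('b \<Rightarrow> nat) set" where
  "weak_compositions S m = {a. (\<forall>c. c \<notin> S \<longrightarrow> a c = 0) \<and> sum a S = m}"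

text \<open>The index \<open>i\<close> is the total left for \<open>S\<close>; the new element
  \<open>x\<close> takes the remaining \<open>m - i\<close>. This is the recursion for
  counting.\<close>

lemma weak_compositions_insert:
  assumes "finite S" "x \<notin> S"
  shows "bij_betw (\<lambda>(i, a). a(x := m - i)) (SIGMA i:{0..m}. weak_compositions S i)
           (weak_compositions (insert x S) m)"
proof (rule bij_betw_byWitness[where f' = "\<lambda>a. (m - a x, a(x := 0))"])
  have upd: "sum (a(x := j)) S = sum a S" for a :: "'a \<Rightarrow> nat" and j
    using assms by (intro sum.cong) auto
  show "\<forall>p\<in>SIGMA i:{0..m}. weak_compositions S i.
      (\<lambda>a. (m - a x, a(x := 0))) ((\<lambda>(i, a). a(x := m - i)) p) = p"
    using assms by (auto simp: weak_compositions_def fun_eq_iff)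
  show "\<forall>a\<in>weak_compositions (insert x S) m.
      (\<lambda>(i, a). a(x := m - i)) ((\<lambda>a. (m - a x, a(x := 0))) a) = a"
    using assms by (auto simp: weak_compositions_def)
  show "(\<lambda>(i, a). a(x := m - i)) ` (SIGMA i:{0..m}. weak_compositions S i)
      \<subseteq> weak_compositions (insert x S) m"
    using assms by (auto simp: weak_compositions_def upd simp del: fun_upd_apply) auto
  show "(\<lambda>a. (m - a x, a(x := 0))) ` weak_compositions (insert x S) m
      \<subseteq> (SIGMA i:{0..m}. weak_compositions S i)"
    using assms by (auto simp: weak_compositions_def upd simp del: fun_upd_apply) auto
qed

lemma finite_weak_compositions:
  assumes "finite S"
  shows "finite (weak_compositions S m)"
  using assms
proof (induction S arbitrary: m)
  case empty
  have "weak_compositions {} m \<subseteq> {\<lambda>_::'a. 0}" by (auto simp: weak_compositions_def)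
  then show ?case using finite_subset by blast
next
  case (insert x S)
  then show ?case
    using bij_betw_finite[OF weak_compositions_insert[OF insert.hyps, of m]] by auto
qed

text \<open>A new element of \<open>S\<close> replaces the counting sequence by its partial sums,
  that is, multiplies the series by the geometric series, the inverse of
  \<open>1 - fps_X\<close>.\<close>

lemma weak_compositions_fps:
  assumes "finite S"
  shows "Abs_fps (\<lambda>m. int (card (weak_compositions S m))) * (1 - fps_X) ^ card S = 1"
  using assms
proof (induction S)
  case empty
  have "weak_compositions {} m = (if m = 0 then {\<lambda>_::'a. 0} else {})" for m
    by (auto simp: weak_compositions_def)
  then show ?case by (auto simp: fps_eq_iff)
next
  case (insert x S)
  let ?F = "\<lambda>S. Abs_fps (\<lambda>m. int (card (weak_compositions (S :: 'a set) m)))"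
  have "card (weak_compositions (insert x S) m) = (\<Sum>i=0..m. card (weak_compositions S i))" for m
    using bij_betw_same_card[OF weak_compositions_insert[OF insert.hyps, of m], symmetric]
    by (simp add: card_SigmaI finite_weak_compositions insert.hyps)
  then have F: "?F (insert x S) = ?F S * Abs_fps (\<lambda>_. 1)"
    by (simp add: fps_eq_iff fps_mult_nth)
  have geo: "Abs_fps (\<lambda>_. 1 :: int) * (1 - fps_X) = 1"
    by (simp add: fps_eq_iff right_diff_distrib)
  have "?F (insert x S) * (1 - fps_X) ^ card (insert x S)
      = (?F S * (1 - fps_X) ^ card S) * (Abs_fps (\<lambda>_. 1) * (1 - fps_X))"
    using insert.hyps by (simp add: F mult_ac)
  then show ?case using insert.IH geo by simp
qed

subsection \<open>Lattice points in barycentric coordinates\<close>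

locale lattice_simplex_vertices =
  fixes M C :: "'a::euclidean_space set"
  assumes lattice: "is_lattice M"
    and affine_independent: "\<not> affine_dependent C"
    and vertices_in_lattice: "C \<subseteq> M"
begin

lemma finite_C [simp]: "finite C"
  using affine_independent by (rule aff_independent_finite)

definition point :: "('a \<Rightarrow> real) \<Rightarrow> 'a" where
  "point \<mu> = (\<Sum>c\<in>C. \<mu> c *\<^sub>R c)"

text \<open>Such a \<open>\<mu>\<close> encodes the pair \<open>(point \<mu>, sum \<mu> C)\<close>,
  a lattice point at integer level in the space spanned by the cone over the simplex. Negative
  entries are allowed, so that these vectors form a group.\<close>

definition coords :: "('a \<Rightarrow> real) set" where
  "coords = {\<mu>. (\<forall>c. c \<notin> C \<longrightarrow> \<mu> c = 0) \<and> sum \<mu> C \<in> \<int> \<and> point \<mu> \<in> M}"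

text \<open>The lattice points of the half-open fundamental parallelepiped: representatives of
  \<open>coords\<close> modulo integer vectors, hence the group \<open>G\<close> with addition
  modulo 1.\<close>

definition box :: "('a \<Rightarrow> real) set" where
  "box = {\<mu> \<in> coords. \<forall>c. 0 \<le> \<mu> c \<and> \<mu> c < 1}"

definition height :: "('a \<Rightarrow> real) \<Rightarrow> nat" where
  "height \<mu> = nat \<lfloor>sum \<mu> C\<rfloor>"

lemma point_add: "point (\<lambda>c. \<mu> c + \<nu> c) = point \<mu> + point \<nu>"
  by (simp add: point_def scaleR_add_left sum.distrib)

lemma point_diff: "point (\<lambda>c. \<mu> c - \<nu> c) = point \<mu> - point \<nu>"
  by (simp add: point_def scaleR_diff_left sum_subtractf)

lemma point_of_int: "point (\<lambda>c. of_int (k c)) \<in> M"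
  unfolding point_def using vertices_in_lattice
  by (intro lattice_sum lattice_scale_int lattice) auto

text \<open>The difference of two distinct such vectors would have coefficient sum 0 and give the
  zero combination, which is an affine dependence of \<open>C\<close>.\<close>

lemma point_inj:
  assumes "\<And>c. c \<notin> C \<Longrightarrow> \<mu> c = 0" "\<And>c. c \<notin> C \<Longrightarrow> \<nu> c = 0"
    and "sum \<mu> C = sum \<nu> C" "point \<mu> = point \<nu>"
  shows "\<mu> = \<nu>"
proof (rule ccontr)
  assume "\<mu> \<noteq> \<nu>"
  then obtain c where "\<mu> c \<noteq> \<nu> c" by blast
  moreover from this have "c \<in> C" using assms(1,2) by metis
  ultimately have "\<exists>c\<in>C. \<mu> c - \<nu> c \<noteq> 0" by auto
  moreover have "(\<Sum>c\<in>C. \<mu> c - \<nu> c) = 0" using assms(3) by (simp add: sum_subtractf)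
  moreover have "(\<Sum>c\<in>C. (\<mu> c - \<nu> c) *\<^sub>R c) = 0"
    using assms(4) point_diff[of \<mu> \<nu>] by (simp add: point_def)
  ultimately have "affine_dependent C"
    unfolding affine_dependent_explicit_finite[OF finite_C]
    by (intro exI[of _ "\<lambda>c. \<mu> c - \<nu> c"]) simp
  with affine_independent show False by contradiction
qed

lemma coords_add: "\<mu> \<in> coords \<Longrightarrow> \<nu> \<in> coords \<Longrightarrow> (\<lambda>c. \<mu> c + \<nu> c) \<in> coords"
  by (auto simp: coords_def point_add sum.distrib intro: lattice_add[OF lattice])

lemma coords_diff: "\<mu> \<in> coords \<Longrightarrow> \<nu> \<in> coords \<Longrightarrow> (\<lambda>c. \<mu> c - \<nu> c) \<in> coords"
  by (auto simp: coords_def point_diff sum_subtractf intro: lattice_diff[OF lattice])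

lemma coords_of_int: "(\<And>c. c \<notin> C \<Longrightarrow> k c = 0) \<Longrightarrow> (\<lambda>c. of_int (k c)) \<in> coords"
  by (auto simp: coords_def point_of_int simp flip: of_int_sum)

lemma zero_in_box: "(\<lambda>_. 0) \<in> box"
  using coords_of_int[of "\<lambda>_. 0"] by (simp add: box_def)

lemma coords_uminus: "\<mu> \<in> coords \<Longrightarrow> (\<lambda>c. - \<mu> c) \<in> coords"
  using coords_diff[of "\<lambda>_. 0" \<mu>] zero_in_box by (simp add: box_def)

text \<open>Rounding down gives an integer vector supported on \<open>C\<close>; it lies in
  \<open>coords\<close> because the vertices are lattice points, and subtracting it stays in the
  group.\<close>

lemma frac_in_box:
  assumes "\<mu> \<in> coords"
  shows "(\<lambda>c. frac (\<mu> c)) \<in> box"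
proof -
  have "(\<lambda>c. of_int \<lfloor>\<mu> c\<rfloor>) \<in> coords"
    using assms by (intro coords_of_int) (auto simp: coords_def)
  from coords_diff[OF assms this] show ?thesis
    by (auto simp: box_def frac_def[symmetric] frac_lt_1)
qed

lemma box_subset_coords: "box \<subseteq> coords"
  by (auto simp: box_def)

lemma frac_box: "\<beta> \<in> box \<Longrightarrow> frac (\<beta> c) = \<beta> c"
  by (simp add: box_def frac_eq)

lemma height_box:
  assumes "\<beta> \<in> box"
  shows "real (height \<beta>) = sum \<beta> C"
proof -
  have "sum \<beta> C \<in> \<int>" "0 \<le> sum \<beta> C"
    using assms by (auto simp: box_def coords_def intro: sum_nonneg)
  then show ?thesis by (auto simp: height_def elim!: Ints_cases)
qed

text \<open>A vector is determined by its point and its level. The points lie in a ball intersected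
  with \<open>M\<close>, and the levels are bounded integers.\<close>

lemma finite_coords_bounded:
  "finite {\<mu> \<in> coords. (\<forall>c. 0 \<le> \<mu> c) \<and> sum \<mu> C \<le> r}"
proof -
  let ?X = "{\<mu> \<in> coords. (\<forall>c. 0 \<le> \<mu> c) \<and> sum \<mu> C \<le> r}"
  let ?h = "\<lambda>\<mu>. (point \<mu>, \<lfloor>sum \<mu> C\<rfloor>)"
  have "inj_on ?h coords"
  proof (rule inj_onI)
    fix \<mu> \<nu> assume *: "\<mu> \<in> coords" "\<nu> \<in> coords" "?h \<mu> = ?h \<nu>"
    then have "sum \<mu> C = sum \<nu> C"
      by (auto simp: coords_def elim!: Ints_cases)
    with * show "\<mu> = \<nu>" by (intro point_inj) (auto simp: coords_def)
  qed
  then have inj: "inj_on ?h ?X" by (rule inj_on_subset) auto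
  have "?h ` ?X \<subseteq> (cball 0 (\<Sum>c\<in>C. \<bar>r\<bar> * norm c) \<inter> M) \<times> {0..\<lfloor>r\<rfloor>}"
  proof safe
    fix \<mu> assume \<mu>: "\<mu> \<in> coords" "\<forall>c. 0 \<le> \<mu> c" "sum \<mu> C \<le> r"
    show "point \<mu> \<in> M" using \<mu> by (simp add: coords_def)
    have "norm (\<mu> c *\<^sub>R c) \<le> \<bar>r\<bar> * norm c" if "c \<in> C" for c
    proof -
      have "\<mu> c \<le> sum \<mu> C" using \<mu>(2) that by (intro member_le_sum) auto
      then show ?thesis using \<mu>(2,3) by (auto intro!: mult_right_mono)
    qed
    then show "point \<mu> \<in> cball 0 (\<Sum>c\<in>C. \<bar>r\<bar> * norm c)"
      unfolding point_def by (simp add: sum_norm_le)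
    show "\<lfloor>sum \<mu> C\<rfloor> \<in> {0..\<lfloor>r\<rfloor>}"
      using \<mu> by (auto intro: sum_nonneg floor_mono)
  qed
  then have "finite (?h ` ?X)"
    by (rule finite_subset) (simp add: finite_bounded_Int_lattice lattice)
  with inj show ?thesis by (rule finite_imageD[rotated])
qed

lemma finite_box [simp]: "finite box"
proof (rule finite_subset)
  show "box \<subseteq> {\<mu> \<in> coords. (\<forall>c. 0 \<le> \<mu> c) \<and> sum \<mu> C \<le> card C}"
  proof safe
    fix \<beta> assume "\<beta> \<in> box"
    then have "\<And>c. \<beta> c \<le> 1" by (auto simp: box_def intro: less_imp_le)
    then show "sum \<beta> C \<le> card C"
      using sum_bounded_above[of C \<beta> 1] by simp
  qed (auto simp: box_def)
qed (rule finite_coords_bounded)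

subsection \<open>The h*-polynomial\<close>

lemma dilation_eq_point_image:
  assumes "C \<noteq> {}"
  shows
  "(\<lambda>x. real k *\<^sub>R x) ` (convex hull C) \<inter> M
    = point ` {\<mu> \<in> coords. (\<forall>c. 0 \<le> \<mu> c) \<and> sum \<mu> C = real k}"
proof safe
  fix x assume x: "x \<in> convex hull C" "real k *\<^sub>R x \<in> M"
  then obtain u where u: "\<And>c. c \<in> C \<Longrightarrow> 0 \<le> u c" "sum u C = 1" "(\<Sum>c\<in>C. u c *\<^sub>R c) = x"
    unfolding convex_hull_finite[OF finite_C] by blast
  define \<mu> where "\<mu> c = (if c \<in> C then real k * u c else 0)" for c
  have point: "point \<mu> = real k *\<^sub>R x"
    unfolding u(3)[symmetric] by (simp add: point_def \<mu>_def scaleR_sum_right)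
  have sum: "sum \<mu> C = real k"
    using u(2) by (simp add: \<mu>_def flip: sum_distrib_left)
  have "\<mu> \<in> coords"
    using x point sum by (simp add: coords_def) (simp add: \<mu>_def)
  moreover have "0 \<le> \<mu> c" for c using u(1) by (simp add: \<mu>_def)
  ultimately show "real k *\<^sub>R x \<in> point ` {\<mu> \<in> coords. (\<forall>c. 0 \<le> \<mu> c) \<and> sum \<mu> C = real k}"
    using point sum by (intro image_eqI[of _ _ \<mu>]) auto
next
  fix \<mu> assume \<mu>: "\<mu> \<in> coords" "\<forall>c. 0 \<le> \<mu> c" "sum \<mu> C = real k"
  then show "point \<mu> \<in> M" by (simp add: coords_def)
  show "point \<mu> \<in> (\<lambda>x. real k *\<^sub>R x) ` (convex hull C)"
  proof (cases "k = 0")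
    case False
    then have "point (\<lambda>c. \<mu> c / real k) \<in> convex hull C"
      using \<mu> by (auto simp: convex_hull_finite point_def simp flip: sum_divide_distrib
          intro!: exI[of _ "\<lambda>c. \<mu> c / real k"])
    moreover have "point \<mu> = real k *\<^sub>R point (\<lambda>c. \<mu> c / real k)"
      using False by (simp add: point_def scaleR_sum_right)
    ultimately show ?thesis by blast
  next
    \<comment> \<open>At \<open>k = 0\<close> rescaling is impossible. All coordinates vanish, and
      the zero dilate of the nonempty hull is the origin.\<close>
    case True
    then have "\<mu> c = 0" if "c \<in> C" for c
      using \<mu>(2,3) that by (simp add: sum_nonneg_eq_0_iff)
    then have "point \<mu> = 0" by (simp add: point_def)
    moreover obtain c where "c \<in> convex hull C"
      using assms hull_inc[of _ C convex] by blast
    ultimately show ?thesis using True by (auto intro!: image_eqI[of _ _ c])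
  qed
qed

text \<open>A nonnegative vector at level \<open>k\<close> splits uniquely into its fractional part,
  in \<open>box\<close>, and its integer part, which distributes the remaining
  \<open>k - height \<beta>\<close> over \<open>C\<close>.\<close>

lemma floor_frac_bij:
  "bij_betw (\<lambda>(\<beta>, a) c. \<beta> c + real (a c))
     (SIGMA \<beta>:{\<beta> \<in> box. height \<beta> \<le> k}. weak_compositions C (k - height \<beta>))
     {\<mu> \<in> coords. (\<forall>c. 0 \<le> \<mu> c) \<and> sum \<mu> C = real k}"
proof (rule bij_betw_byWitness[where f' = "\<lambda>\<mu>. (\<lambda>c. frac (\<mu> c), \<lambda>c. nat \<lfloor>\<mu> c\<rfloor>)"])
  let ?S = "SIGMA \<beta>:{\<beta> \<in> box. height \<beta> \<le> k}. weak_compositions C (k - height \<beta>)"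
  let ?L = "{\<mu> \<in> coords. (\<forall>c. 0 \<le> \<mu> c) \<and> sum \<mu> C = real k}"
  let ?f = "\<lambda>(\<beta>, a) c. \<beta> c + real (a c)"
  let ?g = "\<lambda>\<mu>. (\<lambda>c. frac (\<mu> c), \<lambda>c. nat \<lfloor>\<mu> c\<rfloor>)"
  have "frac (\<beta> c + real m) = \<beta> c \<and> \<lfloor>\<beta> c\<rfloor> = 0" if "\<beta> \<in> box" for \<beta> c m
    using that by (auto simp: box_def frac_def floor_eq_iff)
  then show "\<forall>p\<in>?S. ?g (?f p) = p"
    by auto
  show "\<forall>\<mu>\<in>?L. ?f (?g \<mu>) = \<mu>"
    by (auto simp: frac_def)
  show "?f ` ?S \<subseteq> ?L"
  proof safe
    fix \<beta> a assume *: "\<beta> \<in> box" "height \<beta> \<le> k" "a \<in> weak_compositions C (k - height \<beta>)"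
    show "(\<lambda>c. \<beta> c + real (a c)) \<in> coords"
      using coords_add[of \<beta> "\<lambda>c. real (a c)"] coords_of_int[of "\<lambda>c. int (a c)"] *
      by (simp add: weak_compositions_def box_def)
    show "0 \<le> \<beta> c + real (a c)" for c using *(1) by (simp add: box_def)
    show "(\<Sum>c\<in>C. \<beta> c + real (a c)) = real k"
      using * by (simp add: sum.distrib weak_compositions_def height_box[symmetric] flip: of_nat_sum)
  qed
  show "?g ` ?L \<subseteq> ?S"
  proof (rule image_subsetI)
    fix \<mu> assume \<mu>: "\<mu> \<in> ?L"
    let ?\<beta> = "\<lambda>c. frac (\<mu> c)"
    have \<beta>: "?\<beta> \<in> box" using \<mu> frac_in_box by blast
    have "real (height ?\<beta>) + real (\<Sum>c\<in>C. nat \<lfloor>\<mu> c\<rfloor>) = (\<Sum>c\<in>C. ?\<beta> c + real (nat \<lfloor>\<mu> c\<rfloor>))"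
      by (simp add: height_box[OF \<beta>] sum.distrib)
    also have "\<dots> = real k" using \<mu> by (auto simp: frac_def)
    finally have "height ?\<beta> + (\<Sum>c\<in>C. nat \<lfloor>\<mu> c\<rfloor>) = k"
      by linarith
    with \<beta> \<mu> show "?g \<mu> \<in> ?S" by (auto simp: weak_compositions_def coords_def)
  qed
qed

text \<open>Each \<open>\<beta>\<close> contributes the series of weak compositions shifted by
  \<open>height \<beta>\<close>, and the power of \<open>1 - fps_X\<close> cancels the
  series.\<close>

lemma ehrhart_series_times:
  assumes "C \<noteq> {}"
  shows "ehrhart_series M (convex hull C) * (1 - fps_X) ^ card C
    = fps_of_poly (\<Sum>\<beta>\<in>box. monom 1 (height \<beta>))"
proof -
  let ?W = "Abs_fps (\<lambda>m. int (card (weak_compositions C m)))"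
  let ?L = "\<lambda>k. {\<mu> \<in> coords. (\<forall>c. 0 \<le> \<mu> c) \<and> sum \<mu> C = real k}"
  have "fps_nth (ehrhart_series M (convex hull C)) k
      = fps_nth (\<Sum>\<beta>\<in>box. fps_X ^ height \<beta> * ?W) k" for k
  proof -
    have "inj_on point (?L k)"
      by (rule inj_onI) (rule point_inj, auto simp: coords_def)
    then have "fps_nth (ehrhart_series M (convex hull C)) k = int (card (?L k))"
      by (simp add: ehrhart_series_def dilation_eq_point_image[OF assms] card_image)
    also have "card (?L k)
        = (\<Sum>\<beta>\<in>{\<beta> \<in> box. height \<beta> \<le> k}. card (weak_compositions C (k - height \<beta>)))"
      unfolding bij_betw_same_card[OF floor_frac_bij, symmetric]
      by (simp add: card_SigmaI finite_weak_compositions)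
    also have "int \<dots> = (\<Sum>\<beta>\<in>box. if k < height \<beta> then 0
        else int (card (weak_compositions C (k - height \<beta>))))"
      by (simp add: sum.inter_filter not_le[symmetric] if_distrib cong: if_cong)
        (rule sum.cong, auto)
    finally show ?thesis by (simp add: fps_sum_nth fps_X_power_mult_nth cong: if_cong)
  qed
  then have "ehrhart_series M (convex hull C) = (\<Sum>\<beta>\<in>box. fps_X ^ height \<beta>) * ?W"
    by (simp add: fps_eq_iff sum_distrib_right)
  then have "ehrhart_series M (convex hull C) * (1 - fps_X) ^ card C
      = (\<Sum>\<beta>\<in>box. fps_X ^ height \<beta>) * (?W * (1 - fps_X) ^ card C)"
    by (simp add: mult.assoc)
  then show ?thesis
    by (simp add: weak_compositions_fps fps_of_poly_sum fps_of_poly_monom)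
qed

lemma hstar_poly_eq:
  assumes "C \<noteq> {}"
  shows "hstar_poly M (convex hull C) = (\<Sum>\<beta>\<in>box. monom 1 (height \<beta>))"
proof -
  have "nat (aff_dim (convex hull C) + 1) = card C"
    using affine_independent affine_independent_iff_card[of C] by (simp add: aff_dim_convex_hull)
  then show ?thesis
    unfolding hstar_poly_def by (simp add: ehrhart_series_times[OF assms] fps_of_poly_eq_iff)
qed

lemma height_le_degree:
  assumes "\<beta> \<in> box"
  shows "height \<beta> \<le> lattice_degree M (convex hull C)"
proof (cases "C = {}")
  case False
  \<comment> \<open>The coefficient counts the box elements of the same height as
    \<open>\<beta>\<close>, so nothing can cancel.\<close>
  have "0 < (\<Sum>\<gamma>\<in>box. if height \<gamma> = height \<beta> then 1 else 0 :: int)"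
    using assms by (intro sum_pos2[of _ \<beta>]) auto
  then have "coeff (hstar_poly M (convex hull C)) (height \<beta>) \<noteq> 0"
    by (simp add: hstar_poly_eq[OF False] coeff_sum)
  then show ?thesis unfolding lattice_degree_def by (rule le_degree)
next
  case True
  then show ?thesis unfolding height_def by simp
qed

subsection \<open>A coordinate on which the box vanishes\<close>

text \<open>Translation by \<open>\<beta>\<^sub>0\<close> injects the elements vanishing at
  \<open>c\<close> into the others, so at least half do not vanish there. On those, negation modulo
  1 swaps \<open>x\<close> and \<open>1 - x\<close>, giving average \<open>1/2\<close>.\<close>

lemma box_coordinate_average_ge:
  assumes "\<beta>\<^sub>0 \<in> box" "\<beta>\<^sub>0 c \<noteq> 0"
  shows "real (card box) \<le> 4 * (\<Sum>\<beta>\<in>box. \<beta> c)"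
proof -
  let ?Z = "{\<beta> \<in> box. \<beta> c = 0}" and ?N = "{\<beta> \<in> box. \<beta> c \<noteq> 0}"
  let ?t = "\<lambda>\<beta> e. frac (\<beta> e + \<beta>\<^sub>0 e)" and ?n = "\<lambda>\<beta> e. frac (- \<beta> e)"
  have "inj_on ?t box"
  proof (rule inj_onI)
    fix \<beta> \<gamma> assume *: "\<beta> \<in> box" "\<gamma> \<in> box" "?t \<beta> = ?t \<gamma>"
    show "\<beta> = \<gamma>"
    proof
      fix e
      have "frac (\<beta> e + \<beta>\<^sub>0 e) = frac (\<gamma> e + \<beta>\<^sub>0 e)" using *(3) by meson
      \<comment> \<open>Equal translates differ by an integer before translation, and two numbers in
        \<open>[0, 1)\<close> differing by an integer coincide.\<close>
      then have diff: "\<beta> e - \<gamma> e = of_int (\<lfloor>\<beta> e + \<beta>\<^sub>0 e\<rfloor> - \<lfloor>\<gamma> e + \<beta>\<^sub>0 e\<rfloor>)" (is "_ = of_int ?m")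
        by (simp add: frac_def)
      have "0 \<le> \<beta> e" "\<beta> e < 1" "0 \<le> \<gamma> e" "\<gamma> e < 1"
        using *(1,2) by (auto simp: box_def)
      then have "\<bar>real_of_int ?m\<bar> < 1" unfolding diff[symmetric] by linarith
      then have "?m = 0" by linarith
      with diff show "\<beta> e = \<gamma> e" by simp
    qed
  qed
  then have "inj_on ?t ?Z" by (rule inj_on_subset) auto
  moreover have "?t ` ?Z \<subseteq> ?N"
    using assms by (auto intro!: frac_in_box coords_add simp: frac_box box_subset_coords[THEN subsetD])
  ultimately have "card ?Z \<le> card ?N"
    by (intro card_inj_on_le[of ?t]) auto
  moreover have "card box = card ?Z + card ?N"
    by (subst card_Un_disjoint[symmetric]) (auto intro: arg_cong[of _ _ card])
  ultimately have half: "card box \<le> 2 * card ?N" by simp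
  have "frac (- frac (- \<beta> e)) = \<beta> e" if "\<beta> \<in> box" for \<beta> e
    unfolding frac_unique_iff using that by (auto simp: box_def frac_def)
  then have "bij_betw ?n box box"
    by (intro bij_betw_byWitness[where f' = ?n])
      (auto intro!: frac_in_box coords_uminus simp: box_subset_coords[THEN subsetD])
  then have "(\<Sum>\<beta>\<in>box. frac (- \<beta> c)) = (\<Sum>\<beta>\<in>box. \<beta> c)"
    by (rule sum.reindex_bij_betw[where g = "\<lambda>\<beta>. \<beta> c"])
  \<comment> \<open>Adding the sum to its reindexing by negation turns every nonzero coordinate into
    1 and leaves zeros at 0.\<close>
  then have "2 * (\<Sum>\<beta>\<in>box. \<beta> c) = (\<Sum>\<beta>\<in>box. \<beta> c + frac (- \<beta> c))"
    by (simp add: sum.distrib)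
  also have "\<dots> = (\<Sum>\<beta>\<in>box. if \<beta> c \<noteq> 0 then 1 else 0)"
  proof (rule sum.cong)
    fix \<beta> assume \<beta>: "\<beta> \<in> box"
    then have "\<beta> c \<in> \<int> \<longleftrightarrow> \<beta> c = 0" using frac_box frac_eq_0_iff by metis
    then show "\<beta> c + frac (- \<beta> c) = (if \<beta> c \<noteq> 0 then 1 else 0)"
      by (simp add: frac_neg frac_box[OF \<beta>])
  qed simp
  also have "\<dots> = real (card ?N)"
    by (simp flip: sum.inter_filter)
  finally show ?thesis using half by linarith
qed

lemma box_vanishing_vertex:
  assumes "C \<noteq> {}" "lattice_degree M (convex hull C) \<le> d" "4 * d \<le> card C"
  shows "\<exists>w\<in>C. \<forall>\<beta>\<in>box. \<beta> w = 0"
proof (rule ccontr)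
  assume "\<not> ?thesis"
  then have nz: "\<exists>\<beta>\<in>box. \<beta> c \<noteq> 0" if "c \<in> C" for c
    using that by blast
  have "real (card C * card box) = (\<Sum>c\<in>C. real (card box))" by simp
  also have "\<dots> \<le> (\<Sum>c\<in>C. 4 * (\<Sum>\<beta>\<in>box. \<beta> c))"
    using nz box_coordinate_average_ge by (intro sum_mono) blast
  also have "\<dots> = 4 * (\<Sum>\<beta>\<in>box. sum \<beta> C)"
    unfolding sum_distrib_left[symmetric] by (subst sum.swap) (rule refl)
  also have "\<dots> = 4 * (\<Sum>\<beta>\<in>box. real (height \<beta>))"
    by (simp add: height_box)
  also have "\<dots> = real (4 * (\<Sum>\<beta>\<in>box. height \<beta>))" by simp
  finally have "card C * card box \<le> 4 * (\<Sum>\<beta>\<in>box. height \<beta>)"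
    by (simp only: of_nat_le_iff)
  \<comment> \<open>Removing the zero vector, of height 0, is what gains the factor
    \<open>card box - 1\<close> and makes the final inequality impossible.\<close>
  also have "(\<Sum>\<beta>\<in>box. height \<beta>) = (\<Sum>\<beta>\<in>box - {\<lambda>_. 0}. height \<beta>)"
    by (rule sum.mono_neutral_right) (auto simp: height_def)
  also have "\<dots> \<le> card (box - {\<lambda>_. 0}) * d"
    using sum_bounded_above[of "box - {\<lambda>_. 0}" height d] height_le_degree assms(2)
    by (metis DiffD1 of_nat_id order_trans)
  finally have "card C * card box \<le> 4 * d * (card box - 1)"
    by (simp add: card_Diff_singleton[OF zero_in_box] mult.commute)
  also have "\<dots> \<le> card C * (card box - 1)"
    using assms(3) by simp
  finally have "card C = 0 \<or> card box = 0"
    by (cases "card box") auto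
  then show False using assms(1) zero_in_box by auto
qed

end

subsection \<open>Splitting off a pyramid apex\<close>

lemma lookup_scaleR: "Poly_Mapping.lookup (r *\<^sub>R x) i = r *\<^sub>R Poly_Mapping.lookup x i"
proof -
  have "finite {i. r *\<^sub>R Poly_Mapping.lookup x i \<noteq> 0}"
    by (rule finite_subset[OF _ finite_keys[of x]]) (auto simp: in_keys_iff)
  then show ?thesis by (simp add: scaleR_poly_mapping_def)
qed

text \<open>Enumerating a lattice basis identifies \<open>M\<close> with the integer points of real
  \<open>k\<close>-space. The map is defined on the whole ambient space, so injectivity is claimed
  on \<open>span M\<close> only.\<close>

lemma lattice_coordinates:
  fixes M :: "'a::euclidean_space set"
  assumes "is_lattice M"
  obtains k and \<phi> :: "'a \<Rightarrow> (nat \<Rightarrow>\<^sub>0 real)"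
  where "linear \<phi>" "inj_on \<phi> (span M)" "\<phi> ` M = int_lattice k"
    "\<And>x i. k \<le> i \<Longrightarrow> Poly_Mapping.lookup (\<phi> x) i = 0"
proof -
  obtain A and g :: "'a \<Rightarrow> 'a \<Rightarrow> real" where A: "finite A"
    and M: "M = range (\<lambda>c :: 'a \<Rightarrow> int. \<Sum>a\<in>A. of_int (c a) *\<^sub>R a)"
    and lin: "\<And>a. linear (g a)"
    and g: "\<And>a c. a \<in> A \<Longrightarrow> g a (\<Sum>b\<in>A. c b *\<^sub>R b) = c a"
    by (rule lattice_dual_basis[OF assms]) (rule that)
  obtain e where e: "bij_betw e {..<card A} A"
    using A ex_bij_betw_nat_finite by (auto simp: atLeast0LessThan)
  define \<phi> where "\<phi> x = (\<Sum>i<card A. Poly_Mapping.single i (g (e i) x))" for x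
  have lookup_\<phi>: "Poly_Mapping.lookup (\<phi> x) i = (if i < card A then g (e i) x else 0)" for x i
    by (simp add: \<phi>_def lookup_sum lookup_single when_def)
  have in_A: "e i \<in> A" if "i < card A" for i
    using e that by (auto dest: bij_betwE)
  have "linear \<phi>"
    by (rule linearI; rule poly_mapping_eqI)
      (simp_all add: lookup_\<phi> lookup_add lookup_scaleR linear_add[OF lin] linear_cmul[OF lin])
  moreover have "inj_on \<phi> (span M)"
  proof (rule inj_onI)
    fix x y assume *: "x \<in> span M" "y \<in> span M" "\<phi> x = \<phi> y"
    have lin_expand: "linear (\<lambda>z. \<Sum>a\<in>A. g a z *\<^sub>R a)"
      by (rule linearI) (simp_all add: linear_add[OF lin] linear_cmul[OF lin]
          scaleR_add_left sum.distrib scaleR_sum_right)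
    have "id z = (\<Sum>a\<in>A. g a z *\<^sub>R a)" if "z \<in> M" for z
      using that g unfolding M by auto
    \<comment> \<open>Being the identity is a linear condition, so it passes from \<open>M\<close>
      to its span.\<close>
    then have expand: "id z = (\<Sum>a\<in>A. g a z *\<^sub>R a)" if "z \<in> span M" for z
      by (rule linear_eq_on_span[OF linear_id lin_expand _ that])
    have "g a x = g a y" if a: "a \<in> A" for a
    proof -
      have "a \<in> e ` {..<card A}" using e a by (simp add: bij_betw_def)
      then obtain i where "i < card A" "e i = a" by auto
      then show ?thesis using arg_cong[OF *(3), of "\<lambda>p. Poly_Mapping.lookup p i"]
        by (simp add: lookup_\<phi>)
    qed
    then have "(\<Sum>a\<in>A. g a x *\<^sub>R a) = (\<Sum>a\<in>A. g a y *\<^sub>R a)" by simp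
    then have "id x = id y" unfolding expand[OF *(1)] expand[OF *(2)] .
    then show "x = y" by simp
  qed
  moreover have "\<phi> ` M = int_lattice (card A)"
  proof safe
    fix x assume "x \<in> M"
    then obtain c :: "'a \<Rightarrow> int" where x: "x = (\<Sum>a\<in>A. of_int (c a) *\<^sub>R a)"
      unfolding M by blast
    have "Poly_Mapping.lookup (\<phi> x) i = (if i < card A then of_int (c (e i)) else 0)" for i
      unfolding x by (simp add: lookup_\<phi> g in_A)
    then show "\<phi> x \<in> int_lattice (card A)"
      by (auto simp: int_lattice_def in_keys_iff split: if_splits)
  next
    fix y assume y: "y \<in> int_lattice (card A)"
    define c where "c a = \<lfloor>Poly_Mapping.lookup y (the_inv_into {..<card A} e a)\<rfloor>" for a
    have "y = \<phi> (\<Sum>a\<in>A. of_int (c a) *\<^sub>R a)"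
    proof (rule poly_mapping_eqI)
      fix i
      show "Poly_Mapping.lookup y i = Poly_Mapping.lookup (\<phi> (\<Sum>a\<in>A. of_int (c a) *\<^sub>R a)) i"
      proof (cases "i < card A")
        case True
        then have "the_inv_into {..<card A} e (e i) = i"
          using e by (intro the_inv_into_f_f) (auto simp: bij_betw_def)
        then show ?thesis
          using True y by (simp add: lookup_\<phi> g in_A c_def int_lattice_def)
      next
        case False
        then show ?thesis using y by (auto simp: lookup_\<phi> int_lattice_def in_keys_iff)
      qed
    qed
    then show "y \<in> \<phi> ` M" unfolding M by blast
  qed
  ultimately show thesis
    using that[of \<phi> "card A"] by (simp add: lookup_\<phi>)
qed

context lattice_simplex_vertices
begin

text \<open>
  The isomorphism is written down in the ambient coordinates \<open>\<phi>\<close> of \<open>M\<close>, so that no basis of the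
  lattice points of the facet is needed: it sends the point with barycentric coordinates \<open>\<mu>\<close> to
  \<open>(\<Sum>c \<noteq> w. \<mu> c *\<^sub>R \<phi> c, 1 - \<mu> w)\<close>, an integral point because \<open>\<mu> w\<close> is an integer.
\<close>

lemma lattice_pyramid_facet:
  assumes w: "w \<in> C" and vanish: "\<And>\<beta>. \<beta> \<in> box \<Longrightarrow> \<beta> w = 0"
  shows "lattice_pyramid M (convex hull C) (convex hull (C - {w}))"
proof -
  let ?D = "C - {w}"
  obtain k and \<phi> :: "'a \<Rightarrow> (nat \<Rightarrow>\<^sub>0 real)" where lin: "linear \<phi>" and inj: "inj_on \<phi> (span M)"
    and \<phi>M: "\<phi> ` M = int_lattice k"
    and \<phi>_high: "\<And>x i. k \<le> i \<Longrightarrow> Poly_Mapping.lookup (\<phi> x) i = 0"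
    by (rule lattice_coordinates[OF lattice]) (rule that)
  \<comment> \<open>\<open>\<psi> c\<close> is \<open>\<phi> c\<close> lifted to height one. Below,
    \<open>?B\<close> is the pyramid's base and \<open>?S\<close> its vertex set; the apex
    \<open>0\<close> is the image of \<open>w\<close>.\<close>
  define \<psi> where "\<psi> c = \<phi> c + Poly_Mapping.single k 1" for c
  let ?B = "convex hull (\<phi> ` ?D)"
  let ?S = "insert 0 (\<psi> ` ?D)"
  have D: "\<not> affine_dependent ?D" using affine_independent by (rule affine_independent_Diff)
  have sum_C: "sum h C = h w + sum h ?D" for h :: "'a \<Rightarrow> 'b::comm_monoid_add"
    using w by (simp add: sum.remove)
  have M_span: "x \<in> M \<Longrightarrow> x \<in> span M" for x by (rule span_base)
  have comb_span: "(\<Sum>c\<in>?D. u c *\<^sub>R c) \<in> span M" for u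
    using vertices_in_lattice by (intro span_sum span_scale M_span) auto

  \<comment> \<open>Affine independence of the vertices of the standard pyramid\<close>
  have \<psi>_comb: "(\<Sum>c\<in>?D. u c *\<^sub>R \<psi> c) = \<phi> (\<Sum>c\<in>?D. u c *\<^sub>R c) + Poly_Mapping.single k (sum u ?D)" for u
  proof -
    have "(\<Sum>c\<in>?D. u c *\<^sub>R Poly_Mapping.single k (1 :: real)) = Poly_Mapping.single k (sum u ?D)"
      by (rule poly_mapping_eqI) (simp add: lookup_sum lookup_scaleR lookup_single when_def)
    then show ?thesis
      by (simp add: \<psi>_def scaleR_add_right sum.distrib linear_sum[OF lin] linear_cmul[OF lin])
  qed
  \<comment> \<open>Entry \<open>k\<close> of the relation gives coefficient sum 0, and the other
    entries give the zero combination; affine independence of \<open>?D\<close> then kills all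
    coefficients.\<close>
  have \<psi>_zero: "u c = 0" if "(\<Sum>c\<in>?D. u c *\<^sub>R \<psi> c) = 0" "c \<in> ?D" for u c
  proof -
    have z: "\<phi> (\<Sum>c\<in>?D. u c *\<^sub>R c) + Poly_Mapping.single k (sum u ?D) = 0"
      using that(1) by (simp add: \<psi>_comb)
    from arg_cong[OF this, of "\<lambda>p. Poly_Mapping.lookup p k"] have "sum u ?D = 0"
      by (simp add: lookup_add \<phi>_high)
    moreover from this z have "\<phi> (\<Sum>c\<in>?D. u c *\<^sub>R c) = \<phi> 0"
      by (simp add: linear_0[OF lin])
    then have "(\<Sum>c\<in>?D. u c *\<^sub>R c) = 0"
      using inj comb_span span_zero by (meson inj_onD)
    ultimately show ?thesis
      using D that(2) unfolding affine_dependent_explicit_finite[OF finite_Diff[OF finite_C]] by blast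
  qed
  have inj_\<psi>: "inj_on \<psi> ?D"
  proof (rule inj_onI)
    fix a b assume *: "a \<in> ?D" "b \<in> ?D" "\<psi> a = \<psi> b"
    then have "\<phi> a = \<phi> b" by (simp add: \<psi>_def)
    then show "a = b" using * inj vertices_in_lattice M_span by (auto dest!: inj_onD)
  qed
  have comb_image: "(\<Sum>y\<in>\<psi> ` ?D. v y *\<^sub>R y) = (\<Sum>c\<in>?D. v (\<psi> c) *\<^sub>R \<psi> c)" for v
    using inj_\<psi> by (simp add: sum.reindex)
  have "0 \<notin> \<psi> ` ?D"
  proof
    assume "0 \<in> \<psi> ` ?D"
    then obtain c where "c \<in> ?D" "\<psi> c = 0" by (metis imageE)
    then have "(\<Sum>b\<in>?D. (if b = c then 1 else 0) *\<^sub>R \<psi> b) = 0"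
      by (intro sum.neutral) auto
    from \<psi>_zero[OF this \<open>c \<in> ?D\<close>] show False by simp
  qed
  moreover have "independent (\<psi> ` ?D)"
    by (rule independent_if_scalars_zero) (auto simp: comb_image dest: \<psi>_zero)
  ultimately have indep: "\<not> affine_dependent ?S"
    by (simp add: affine_dependent_iff_dependent)

  \<comment> \<open>The pyramid and its base as hulls of their vertices\<close>
  have height_one: "height_one k ?B = convex hull (\<psi> ` ?D)"
    using convex_hull_translation[of "Poly_Mapping.single k 1" "\<phi> ` ?D"]
    by (simp add: height_one_def \<psi>_def image_image add.commute)
  have pyramid: "standard_pyramid 1 k ?B = convex hull ?S"
    using hull_insert[of convex 0 "\<psi> ` ?D"] by (simp add: height_one)
  have base: "pyramid_base 1 k ?B = convex hull (\<psi> ` ?D)"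
    by (simp add: height_one)
  have verts_S: "vertices (convex hull ?S) = ?S"
    using indep by (intro vertices_convex_hull) auto
  have verts_base: "vertices (convex hull (\<psi> ` ?D)) = \<psi> ` ?D"
    using affine_independent_subset[OF indep] by (intro vertices_convex_hull) auto
  \<comment> \<open>The apex \<open>0\<close> absorbs any weight, so the coefficients on the
    \<open>\<psi> c\<close> are unconstrained.\<close>
  have aff_S: "affine hull ?S = range (\<lambda>u. \<Sum>c\<in>?D. u c *\<^sub>R \<psi> c)"
  proof -
    have "affine hull ?S = span (\<psi> ` ?D)"
      using affine_hull_span_0[of ?S] hull_inc[of 0 ?S affine] by simp
    also have "\<dots> = range (\<lambda>u. \<Sum>c\<in>?D. u c *\<^sub>R \<psi> c)"
    proof safe
      fix y assume "y \<in> span (\<psi> ` ?D)"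
      then obtain v where "y = (\<Sum>z\<in>\<psi> ` ?D. v z *\<^sub>R z)"
        by (auto simp: span_finite)
      then show "y \<in> range (\<lambda>u. \<Sum>c\<in>?D. u c *\<^sub>R \<psi> c)" by (simp add: comb_image)
    qed (intro span_sum span_scale span_base, simp)
    finally show ?thesis .
  qed

  \<comment> \<open>The isomorphism on lattice points\<close>
  define bary where "bary x = (THE \<mu>. (\<forall>c. c \<notin> C \<longrightarrow> \<mu> c = 0) \<and> sum \<mu> C = 1 \<and> point \<mu> = x)" for x
  have bary_point: "bary (point \<mu>) = \<mu>" if "\<And>c. c \<notin> C \<Longrightarrow> \<mu> c = 0" "sum \<mu> C = 1" for \<mu>
    unfolding bary_def using that by (intro the_equality) (auto intro: point_inj)
  have hull_C: "\<exists>\<mu>. (\<forall>c. c \<notin> C \<longrightarrow> \<mu> c = 0) \<and> sum \<mu> C = 1 \<and> x = point \<mu>"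
    if x: "x \<in> affine hull C" for x
  proof -
    obtain u where "sum u C = 1" "(\<Sum>c\<in>C. u c *\<^sub>R c) = x"
      using x unfolding affine_hull_finite[OF finite_C] by blast
    then show ?thesis
      by (intro exI[of _ "\<lambda>c. if c \<in> C then u c else 0"]) (auto simp: point_def)
  qed
  have bary: "\<And>c. c \<notin> C \<Longrightarrow> bary x c = 0" "sum (bary x) C = 1" "point (bary x) = x"
    if x: "x \<in> affine hull C" for x
  proof -
    obtain \<mu> where \<mu>: "\<forall>c. c \<notin> C \<longrightarrow> \<mu> c = 0" "sum \<mu> C = 1" "x = point \<mu>"
      using hull_C[OF x] by blast
    then have "bary x = \<mu>" by (simp add: bary_point)
    with \<mu> show "\<And>c. c \<notin> C \<Longrightarrow> bary x c = 0" "sum (bary x) C = 1" "point (bary x) = x"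
      by simp_all
  qed
  have point_hull: "point \<mu> \<in> affine hull C" if "sum \<mu> C = 1" for \<mu>
    using that unfolding affine_hull_finite[OF finite_C] point_def by blast
  define f where "f x = (\<Sum>c\<in>?D. bary x c *\<^sub>R \<psi> c)" for x
  let ?L = "affine hull C \<inter> M" and ?L' = "affine hull ?S \<inter> int_lattice (k + 1)"
  \<comment> \<open>Here \<open>vanish\<close> enters: the fractional part of \<open>bary x\<close>
    lies in \<open>box\<close>, so its entry at \<open>w\<close> is 0.\<close>
  have int_w: "bary x w \<in> \<int>" if "x \<in> ?L" for x
  proof -
    have "bary x \<in> coords" using that bary[of x] by (auto simp: coords_def)
    from vanish[OF frac_in_box[OF this]] show ?thesis by (simp add: frac_eq_0_iff)
  qed
  have sum_D: "sum (bary x) ?D = 1 - bary x w" if "x \<in> affine hull C" for x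
    using bary(2)[OF that] by (simp add: sum_C)
  have point_C: "point \<mu> = \<mu> w *\<^sub>R w + (\<Sum>c\<in>?D. \<mu> c *\<^sub>R c)" for \<mu>
    by (simp add: point_def sum_C)
  have scale_w: "r *\<^sub>R w \<in> M" if "r \<in> \<int>" for r
    using that w vertices_in_lattice lattice_scale_int[OF lattice] by (auto elim!: Ints_cases)
  have f_vertices: "f ` C = ?S" "f ` ?D = \<psi> ` ?D"
  proof -
    have "f b = (if b = w then 0 else \<psi> b)" if "b \<in> C" for b
    proof -
      let ?\<mu> = "\<lambda>c. if c = b then 1 else 0"
      have "point ?\<mu> = b"
        using that by (simp add: point_def if_distrib[of "\<lambda>r. r *\<^sub>R _"] cong: if_cong)
      moreover have "bary (point ?\<mu>) = ?\<mu>"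
        by (rule bary_point) (use that in auto)
      ultimately have "bary b = ?\<mu>" by simp
      then show ?thesis
        using that by (simp add: f_def if_distrib[of "\<lambda>r. r *\<^sub>R _"] cong: if_cong)
    qed
    then show "f ` C = ?S" "f ` ?D = \<psi> ` ?D"
      using w by (auto simp: image_iff)
  qed
  have "f x \<in> ?L'" if x: "x \<in> ?L" for x
  proof -
    \<comment> \<open>Removing an integer multiple of \<open>w\<close> leaves a lattice point, whose
      image under \<open>\<phi>\<close> is integral.\<close>
    have "x - bary x w *\<^sub>R w = (\<Sum>c\<in>?D. bary x c *\<^sub>R c)"
      using x bary(3)[of x] point_C[of "bary x"] by (simp add: algebra_simps)
    moreover have "x - bary x w *\<^sub>R w \<in> M"
      using x int_w scale_w by (intro lattice_diff[OF lattice]) auto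
    ultimately have "\<phi> (\<Sum>c\<in>?D. bary x c *\<^sub>R c) \<in> int_lattice k"
      using \<phi>M by auto
    moreover have "f x = \<phi> (\<Sum>c\<in>?D. bary x c *\<^sub>R c) + Poly_Mapping.single k (1 - bary x w)"
      unfolding f_def \<psi>_comb using x sum_D by simp
    ultimately have "f x \<in> int_lattice (k + 1)"
      using int_w[OF x]
      by (auto simp: int_lattice_def in_keys_iff lookup_add lookup_single when_def subset_iff
          less_Suc_eq split: if_splits)
    then show ?thesis unfolding aff_S f_def by blast
  qed
  moreover have "y \<in> f ` ?L" if y: "y \<in> ?L'" for y
  proof -
    obtain u where u: "y = (\<Sum>c\<in>?D. u c *\<^sub>R \<psi> c)" using y unfolding aff_S by blast
    \<comment> \<open>The weight of \<open>w\<close> is chosen to make the total 1; it is an integer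
      because entry \<open>k\<close> of \<open>y\<close> is the sum of the other weights.\<close>
    define \<mu> where "\<mu> c = (if c = w then 1 - sum u ?D else if c \<in> C then u c else 0)" for c
    have \<mu>: "\<mu> c = u c" if "c \<in> ?D" for c using that by (simp add: \<mu>_def)
    have sum_\<mu>: "sum \<mu> C = 1" using \<mu> by (simp add: sum_C) (simp add: \<mu>_def)
    have supp_\<mu>: "\<mu> c = 0" if "c \<notin> C" for c using that w by (auto simp: \<mu>_def)
    have y': "y = \<phi> (\<Sum>c\<in>?D. u c *\<^sub>R c) + Poly_Mapping.single k (sum u ?D)"
      by (simp add: u \<psi>_comb)
    have y_int: "Poly_Mapping.lookup y i \<in> \<int>" for i using y by (simp add: int_lattice_def)
    have "Poly_Mapping.lookup y k = sum u ?D"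
      unfolding y' by (simp add: lookup_add \<phi>_high)
    then have int: "sum u ?D \<in> \<int>" using y_int by metis
    have "Poly_Mapping.lookup (\<phi> (\<Sum>c\<in>?D. u c *\<^sub>R c)) i \<in> \<int>" for i
    proof (cases "k \<le> i")
      case False
      then show ?thesis using y_int[of i] unfolding y' by (simp add: lookup_add lookup_single when_def)
    qed (simp add: \<phi>_high)
    moreover have "Poly_Mapping.keys (\<phi> z) \<subseteq> {..<k}" for z
      by (rule subsetI, rule ccontr) (simp add: in_keys_iff \<phi>_high)
    ultimately have "\<phi> (\<Sum>c\<in>?D. u c *\<^sub>R c) \<in> \<phi> ` M"
      unfolding \<phi>M by (simp add: int_lattice_def)
    then obtain z where z: "\<phi> (\<Sum>c\<in>?D. u c *\<^sub>R c) = \<phi> z" "z \<in> M" by (rule imageE)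
    have "(\<Sum>c\<in>?D. u c *\<^sub>R c) \<in> M"
      using inj_onD[OF inj z(1) comb_span M_span[OF z(2)]] z(2) by simp
    moreover have "\<mu> w *\<^sub>R w \<in> M"
      using int by (intro scale_w) (simp add: \<mu>_def)
    ultimately have "point \<mu> \<in> ?L"
      using point_hull[OF sum_\<mu>] \<mu> by (auto simp: point_C intro: lattice_add[OF lattice])
    moreover have "f (point \<mu>) = y"
      using bary_point[OF supp_\<mu> sum_\<mu>] \<mu> by (simp add: f_def u)
    ultimately show ?thesis by blast
  qed
  moreover have "inj_on f ?L"
  proof (rule inj_onI)
    fix x y assume *: "x \<in> ?L" "y \<in> ?L" "f x = f y"
    \<comment> \<open>Independence of the \<open>\<psi> c\<close> recovers the coordinates on
      \<open>?D\<close>, and the total 1 then recovers the one at \<open>w\<close>.\<close>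
    then have "(\<Sum>c\<in>?D. (bary x c - bary y c) *\<^sub>R \<psi> c) = 0"
      by (simp add: f_def scaleR_diff_left sum_subtractf)
    from \<psi>_zero[OF this] have eq: "bary x c = bary y c" if "c \<in> ?D" for c
      using that by simp
    then have "sum (bary x) ?D = sum (bary y) ?D" by (rule sum.cong[OF refl])
    then have "bary x w = bary y w"
      using sum_D[of x] sum_D[of y] * by simp
    with eq have "bary x c = bary y c" if "c \<in> C" for c using that by (cases "c = w") simp_all
    then have "point (bary x) = point (bary y)" by (simp add: point_def)
    then show "x = y" using *(1,2) by (simp add: bary(3))
  qed
  ultimately have bij: "bij_betw f ?L ?L'"
    unfolding bij_betw_def by blast
  have affine: "f (x - y + z) = f x - f y + f z" if "x \<in> ?L" "y \<in> ?L" "z \<in> ?L" for x y z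
  proof -
    \<comment> \<open>The total is \<open>1 - 1 + 1 = 1\<close>, so this is again a barycentric
      vector, and \<open>f\<close> is linear in such vectors.\<close>
    let ?\<mu> = "\<lambda>c. bary x c - bary y c + bary z c"
    have "point ?\<mu> = x - y + z"
      using that bary(3) by (simp add: point_add point_diff)
    moreover have "bary (point ?\<mu>) = ?\<mu>"
      using that bary(1,2) by (intro bary_point) (auto simp: sum.distrib sum_subtractf)
    ultimately have "bary (x - y + z) = ?\<mu>" by simp
    then show ?thesis
      by (simp add: f_def scaleR_add_left scaleR_diff_left sum.distrib sum_subtractf)
  qed

  \<comment> \<open>Codimension one and assembly of the pyramid\<close>
  have "int (card C) = aff_dim C + 1" "int (card ?D) = aff_dim ?D + 1"
    using affine_independent_iff_card[of C] affine_independent_iff_card[of ?D] affine_independent D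
    by simp_all
  moreover have "card C = card ?D + 1" using card.remove[OF finite_C w] by linarith
  ultimately have codim: "nat (aff_dim (convex hull C) - aff_dim (convex hull ?D)) = 1"
    unfolding aff_dim_convex_hull by linarith
  have verts: "vertices (convex hull C) = C" "vertices (convex hull ?D) = ?D"
    using affine_independent D by (simp_all add: vertices_convex_hull)
  have "lattice_polytope M (convex hull C)" "lattice_polytope M (convex hull ?D)"
    using vertices_in_lattice by (auto intro: lattice_polytope_convex_hull)
  moreover have "lattice_polytope (int_lattice k) ?B"
    using vertices_in_lattice \<phi>M[symmetric] by (intro lattice_polytope_convex_hull) auto
  moreover have "convex hull ?D \<subseteq> convex hull C" by (intro hull_mono) auto
  moreover have "lattice_polytope_iso f M (convex hull C) (int_lattice (k + 1)) (standard_pyramid 1 k ?B)"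
    unfolding lattice_polytope_iso_def affine_lattice_iso_def pyramid
      affine_hull_convex_hull verts(1) verts_S
    by (intro conjI ballI bij affine f_vertices(1))
  moreover have "f ` vertices (convex hull ?D) = vertices (pyramid_base 1 k ?B)"
    unfolding base verts verts_base by (rule f_vertices(2))
  ultimately show ?thesis
    unfolding lattice_pyramid_def Let_def codim by (intro conjI exI[of _ k] exI[of _ ?B] exI[of _ f])
qed

end

theorem theorem2p1:
  fixes M P :: "'a::euclidean_space set" and d n :: nat
  assumes "is_lattice M"
    and "lattice_simplex M P"
    and "aff_dim P = int n"
    and "lattice_degree M P \<le> d"
    and "int n \<ge> 4 * int d - 1"
  shows "\<exists>Q. lattice_simplex M Q \<and> aff_dim Q = int n - 1 \<and> lattice_pyramid M P Q"
proof -
  obtain m C where C: "\<not> affine_dependent C" "int (card C) = m + 1" "P = convex hull C"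
    using assms(2) unfolding lattice_simplex_def simplex_def by blast
  then have fin: "finite C" by (simp add: aff_independent_finite)
  have card: "int (card C) = int n + 1"
    using C assms(3) affine_independent_iff_card[of C] by (simp add: aff_dim_convex_hull)
  \<comment> \<open>\<open>C\<close> lies in \<open>M\<close> because it is exactly the vertex set
    of \<open>P\<close>.\<close>
  interpret lattice_simplex_vertices M C
    using assms(1,2) C fin vertices_convex_hull[of C]
    by unfold_locales (auto simp: lattice_simplex_def lattice_polytope_def)
  have "C \<noteq> {}" using card by auto
  \<comment> \<open>The dimension bound becomes a bound on the \<open>n + 1\<close>
    vertices.\<close>
  moreover have "4 * d \<le> card C" using card assms(5) by linarith
  ultimately obtain w where w: "w \<in> C" "\<And>\<beta>. \<beta> \<in> box \<Longrightarrow> \<beta> w = 0"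
    using box_vanishing_vertex[of d] assms(4) unfolding C(3) by blast
  let ?Q = "convex hull (C - {w})"
  have pyr: "lattice_pyramid M P ?Q"
    unfolding C(3) using w by (rule lattice_pyramid_facet)
  \<comment> \<open>For \<open>n = 0\<close> this is the empty simplex, of dimension -1.\<close>
  have "(int n - 1) simplex ?Q"
    using affine_independent_Diff[OF C(1)] card w(1) fin
    by (intro simplex_convex_hull) (auto simp: card_Diff_singleton of_nat_diff Suc_le_eq card_gt_0_iff)
  with pyr show ?thesis
    unfolding lattice_simplex_def using aff_dim_simplex by (auto simp: lattice_pyramid_def)
qed

end
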